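(* Let $F$ be a vector subspace of $\mathcal B(S)$ satisfying conditions (i)–(vi) below, and assume hypothesis (H1) below holds with constant $\alpha\in(0,1)$. Let $f\in F$ with $(\mu,f)=0$. Then for all $r\in\mathbb N$, $$\mathbb E\big[\overline M_{\mathbb G_r}(f)^4\big]\le\begin{cases} c\,(1/4)^r & \text{if } \alpha^2<1/2,\\ c\,r^2(1/4)^r & \text{if } \alpha^2=1/2,\\ c\,\alpha^{4r} & \text{if } \alpha^2>1/2,\end{cases}$$ where $c>0$ is a constant depending on $\alpha$ and $f$ (but not on $r$).
   Context: Binary tree: $\mathbb T=\mathbb N^*$, vertex $n$ having daughters $2n,2n+1$; $\mathbb G_r=\{2^r,\dots,2^{r+1}-1\}$, $\mathbb T_r=\bigcup_{q=0}^r\mathbb G_q$. $(S,\mathcal S)$ is a metric space with Borel $\sigma$-field; $\mathcal B(S^p)$ is the set of measurable real functions on $S^p$. A $\mathbb T$-transition probability $P$ is a Markov kernel from $S$ to $S^2$; $P_0(x,B)=P(x,B\times S)$, $P_1(x,B)=P(x,S\times B)$, $Q=(P_0+P_1)/2$; $Pf(x)=\int f(x,y,z)P(x,dy\,dz)$ for $f\in\mathcal B(S^3)$, and for $f,g\in\mathcal B(S)$, $(f\otimes g)(y,z)=f(y)g(z)$, $P(f\otimes g)(x)=\int f(y)g(z)P(x,dy\,dz)$. $(X_n)_{n\in\mathbb T}$ is a bifurcating Markov chain with initial law $\nu$ and $\mathbb T$-transition probability $P$: with $\mathcal F_r=\sigma(X_i,i\in\mathbb T_r)$, $\mathcal L(X_1)=\nu$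 and for every $r$ and every family $(f_n)_{n\in\mathbb G_r}$ of bounded measurable functions on $S^3$, $\mathbb E[\prod_{n\in\mathbb G_r}f_n(X_n,X_{2n},X_{2n+1})\mid\mathcal F_r]=\prod_{n\in\mathbb G_r}Pf_n(X_n)$. $(Y_r)_{r\ge0}$ denotes a Markov chain on $S$ with transition $Q$, $\mathbb E_x$ meaning $Y_0=x$. $\overline M_{\mathbb G_r}(f)=|\mathbb G_r|^{-1}\sum_{i\in\mathbb G_r}f(X_i)$, and $(\mu,f)=\int f\,d\mu$. Conditions on $F$: (i) $F$ contains constants; (ii) $f^2\in F$ for $f\in F$; (iii) for all $x$ and $f,g\in F$, $f\otimes g\in L^1(P(x,\cdot))$ and $P(f\otimes g)\in F$; (iv) there is a probability $\mu$ on $S$ with $F\subset L^1(\mu)$ and $\lim_r\mathbb E_x[f(Y_r)]=(\mu,f)$ for all $x\in S$, $f\in F$; (v) for every $f\in F$ there is $g\in F$ with $|Q^rf|\le g$ for all $r$; (vi) $F\subset L^1(\nu)$. Hypothesis (H1): there is $\alpha\in(0,1)$ such that for every $f\in F$ with $(\mu,f)=0$ there exists $g\in F$ with $|Q^rf(x)|\le\alpha^r g(x)$ for all $r\in\mathbb N$, $x\in S$.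
   Formalization: In the critical case α² = 1/2 the bound is claimed only for r ≥ 1, because at r = 0 the stated bound c r²(1/4)^r equals 0 and fails whenever f(X_1) is not almost surely zero. *)

theory Defs
  imports "HOL-Probability.Probability"
begin

text \<open>Binary tree: generations G_r and subtrees T_r (vertex n has daughters 2n, 2n+1).\<close>
definition Gen :: "nat \<Rightarrow> nat set" where
  "Gen r = {2^r ..< 2^(r+1)}"

definition Tr :: "nat \<Rightarrow> nat set" where
  "Tr r = (\<Union>q\<in>{0..r}. Gen q)"

definition Pop :: "('a \<Rightarrow> ('a \<times> 'a) measure) \<Rightarrow> ('a \<times> 'a \<times> 'a \<Rightarrow> real) \<Rightarrow> 'a \<Rightarrow> real" where
  "Pop P f x = (\<integral>yz. f (x, fst yz, snd yz) \<partial>(P x))"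

definition Ptens :: "('a \<Rightarrow> ('a \<times> 'a) measure) \<Rightarrow> ('a \<Rightarrow> real) \<Rightarrow> ('a \<Rightarrow> real) \<Rightarrow> 'a \<Rightarrow> real" where
  "Ptens P f g x = (\<integral>yz. f (fst yz) * g (snd yz) \<partial>(P x))"

definition Qop :: "('a \<Rightarrow> ('a \<times> 'a) measure) \<Rightarrow> ('a \<Rightarrow> real) \<Rightarrow> 'a \<Rightarrow> real" where
  "Qop P f x = ((\<integral>yz. f (fst yz) \<partial>(P x)) + (\<integral>yz. f (snd yz) \<partial>(P x))) / 2"

text \<open>Q^r f (x) = E_x[f(Y_r)].\<close>
definition Qpow :: "('a \<Rightarrow> ('a \<times> 'a) measure) \<Rightarrow> nat \<Rightarrow> ('a \<Rightarrow> real) \<Rightarrow> 'a \<Rightarrow> real" where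
  "Qpow P r f = (Qop P ^^ r) f"

definition Mbar :: "(nat \<Rightarrow> 'w \<Rightarrow> 'a) \<Rightarrow> nat \<Rightarrow> ('a \<Rightarrow> real) \<Rightarrow> 'w \<Rightarrow> real" where
  "Mbar X r f \<omega> = (\<Sum>i\<in>Gen r. f (X i \<omega>)) / real (card (Gen r))"

definition Filt :: "'w measure \<Rightarrow> (nat \<Rightarrow> 'w \<Rightarrow> 'a::topological_space) \<Rightarrow> nat \<Rightarrow> 'w measure" where
  "Filt M X r = sigma (space M) {X i -` A \<inter> space M | i A. i \<in> Tr r \<and> A \<in> sets borel}"

definition T_transition :: "('a::topological_space \<Rightarrow> ('a \<times> 'a) measure) \<Rightarrow> bool" where
  "T_transition P \<longleftrightarrow> P \<in> borel \<rightarrow>\<^sub>M subprob_algebra (borel \<Otimes>\<^sub>M borel) \<and> (\<forall>x. prob_space (P x))"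

definition bifurcating_MC ::
  "'w measure \<Rightarrow> (nat \<Rightarrow> 'w \<Rightarrow> 'a::topological_space) \<Rightarrow> 'a measure \<Rightarrow> ('a \<Rightarrow> ('a \<times> 'a) measure) \<Rightarrow> bool" where
  "bifurcating_MC M X \<nu> P \<longleftrightarrow>
     prob_space M \<and> T_transition P \<and>
     (\<forall>n\<ge>1. X n \<in> M \<rightarrow>\<^sub>M borel) \<and>
     distr M borel (X 1) = \<nu> \<and>
     (\<forall>r (fs :: nat \<Rightarrow> 'a \<times> 'a \<times> 'a \<Rightarrow> real).
        (\<forall>n\<in>Gen r. fs n \<in> borel_measurable (borel \<Otimes>\<^sub>M borel \<Otimes>\<^sub>M borel) \<and> (\<exists>B. \<forall>t. \<bar>fs n t\<bar> \<le> B)) \<longrightarrow>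
        (AE \<omega> in M. real_cond_exp M (Filt M X r)
              (\<lambda>\<omega>. \<Prod>n\<in>Gen r. fs n (X n \<omega>, X (2*n) \<omega>, X (2*n+1) \<omega>)) \<omega>
           = (\<Prod>n\<in>Gen r. Pop P (fs n) (X n \<omega>))))"

definition F_conditions ::
  "('a::topological_space \<Rightarrow> real) set \<Rightarrow> ('a \<Rightarrow> ('a \<times> 'a) measure) \<Rightarrow> 'a measure \<Rightarrow> 'a measure \<Rightarrow> bool" where
  "F_conditions F P \<mu> \<nu> \<longleftrightarrow>
     \<comment> \<open>vector subspace of B(S)\<close>
     F \<subseteq> borel_measurable borel \<and>
     (\<forall>f\<in>F. \<forall>g\<in>F. (\<lambda>x. f x + g x) \<in> F) \<and>
     (\<forall>f\<in>F. \<forall>c::real. (\<lambda>x. c * f x) \<in> F) \<and>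
     \<comment> \<open>(i)\<close>
     (\<forall>c::real. (\<lambda>_. c) \<in> F) \<and>
     \<comment> \<open>(ii)\<close>
     (\<forall>f\<in>F. (\<lambda>x. (f x)\<^sup>2) \<in> F) \<and>
     \<comment> \<open>(iii)\<close>
     (\<forall>f\<in>F. \<forall>g\<in>F. (\<forall>x. integrable (P x) (\<lambda>yz. f (fst yz) * g (snd yz))) \<and> Ptens P f g \<in> F) \<and>
     \<comment> \<open>(iv)\<close>
     prob_space \<mu> \<and> sets \<mu> = sets borel \<and>
     (\<forall>f\<in>F. integrable \<mu> f) \<and>
     (\<forall>x. \<forall>f\<in>F. (\<lambda>r. Qpow P r f x) \<longlonglongrightarrow> (\<integral>y. f y \<partial>\<mu>)) \<and>
     \<comment> \<open>(v)\<close>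
     (\<forall>f\<in>F. \<exists>g\<in>F. \<forall>r x. \<bar>Qpow P r f x\<bar> \<le> g x) \<and>
     \<comment> \<open>(vi)\<close>
     (\<forall>f\<in>F. integrable \<nu> f)"

definition hyp_H1 ::
  "('a \<Rightarrow> real) set \<Rightarrow> ('a \<Rightarrow> ('a \<times> 'a) measure) \<Rightarrow> 'a measure \<Rightarrow> real \<Rightarrow> bool" where
  "hyp_H1 F P \<mu> \<alpha> \<longleftrightarrow> 0 < \<alpha> \<and> \<alpha> < 1 \<and>
     (\<forall>f\<in>F. (\<integral>y. f y \<partial>\<mu>) = 0 \<longrightarrow> (\<exists>g\<in>F. \<forall>r x. \<bar>Qpow P r f x\<bar> \<le> \<alpha>^r * g x))"

end

theory Submission
  imports Defs
begin

text \<open>Let \<open>S\<^sub>r\<close> be the sum of \<open>f\<close> over generation \<open>r\<close> and \<open>w\<^sub>k\<^sup>r(x) = E\<^sub>x[S\<^sub>r\<^sup>k]/k!\<close>. Since \<open>S\<^sub>r\<^sub>+\<^sub>1\<close> is the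
  sum over two subtrees that are independent given the daughters of the root,
  \<open>w\<^sub>k\<^sup>r\<^sup>+\<^sup>1 = \<Sum>\<^sub>i\<^sub>\<le>\<^sub>k P(w\<^sub>i\<^sup>r \<otimes> w\<^sub>k\<^sub>-\<^sub>i\<^sup>r) = 2 Q w\<^sub>k\<^sup>r + e\<^sub>k\<^sup>r\<close>, where \<open>e\<^sub>k\<^sup>r\<close> involves only lower moments. With
  \<open>A\<^sub>r = \<Sum>\<^sub>s\<^sub>\<le>\<^sub>r (2\<alpha>\<^sup>2)\<^sup>s\<close>, (H1) gives \<open>|w\<^sub>1\<^sup>r| \<le> (2\<alpha>)\<^sup>r g\<close>, and the affine recursion successively gives
  \<open>|w\<^sub>2\<^sup>r| \<le> 2\<^sup>r A\<^sub>r g\<close>, \<open>|w\<^sub>3\<^sup>r| \<le> 2\<^sup>r (1 + \<Sum>\<^sub>q\<^sub><\<^sub>r (2\<alpha>)\<^sup>q A\<^sub>q) g\<close> and \<open>|w\<^sub>4\<^sup>r| \<le> 4\<^sup>r A\<^sub>r\<^sup>2 g\<close>, each time with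
  another \<open>g \<in> F\<close> and up to constants. Dividing by \<open>16\<^sup>r\<close> leaves \<open>4\<^sup>-\<^sup>r A\<^sub>r\<^sup>2\<close>, and the three regimes are
  those of the geometric sum \<open>A\<^sub>r\<close>.\<close>

section \<open>The class \<open>F\<close>, the operators acting on it and affine recursions\<close>

locale bmc =
  fixes M :: "'w measure" and X :: "nat \<Rightarrow> 'w \<Rightarrow> 'a::topological_space"
    and \<nu> \<mu> :: "'a measure" and P :: "'a \<Rightarrow> ('a \<times> 'a) measure"
    and F :: "('a \<Rightarrow> real) set"
  assumes bmc: "bifurcating_MC M X \<nu> P"
    and F_conds: "F_conditions F P \<mu> \<nu>"
begin

lemma F_measurable: "u \<in> F \<Longrightarrow> u \<in> borel_measurable borel"
  and F_add: "u \<in> F \<Longrightarrow> v \<in> F \<Longrightarrow> (\<lambda>x. u x + v x) \<in> F"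
  and F_scale: "u \<in> F \<Longrightarrow> (\<lambda>x. c * u x) \<in> F"
  and F_const: "(\<lambda>_. c) \<in> F"
  and F_square: "u \<in> F \<Longrightarrow> (\<lambda>x. (u x)\<^sup>2) \<in> F"
  and F_integrable_tens: "u \<in> F \<Longrightarrow> v \<in> F \<Longrightarrow> integrable (P x) (\<lambda>yz. u (fst yz) * v (snd yz))"
  and F_Ptens: "u \<in> F \<Longrightarrow> v \<in> F \<Longrightarrow> Ptens P u v \<in> F"
  and F_Qpow_bound: "u \<in> F \<Longrightarrow> \<exists>g\<in>F. \<forall>r x. \<bar>Qpow P r u x\<bar> \<le> g x"
  and F_integrable: "u \<in> F \<Longrightarrow> integrable \<nu> u"
  using F_conds unfolding F_conditions_def by blast+

text \<open>Polarisation: a vector space closed under squares is an algebra. This provides the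
  powers of \<open>f\<close>.\<close>

lemma F_mult:
  assumes "u \<in> F" "v \<in> F"
  shows "(\<lambda>x. u x * v x) \<in> F"
proof -
  have "(\<lambda>x. 1/2 * (u x + v x)\<^sup>2 + ((-1/2) * (u x)\<^sup>2 + (-1/2) * (v x)\<^sup>2)) \<in> F"
    by (intro F_add F_scale F_square assms)
  also have "(\<lambda>x. 1/2 * (u x + v x)\<^sup>2 + ((-1/2) * (u x)\<^sup>2 + (-1/2) * (v x)\<^sup>2)) = (\<lambda>x. u x * v x)"
    by (auto simp: power2_eq_square algebra_simps)
  finally show ?thesis .
qed

lemma F_power: "u \<in> F \<Longrightarrow> (\<lambda>x. u x ^ k) \<in> F"
  by (induction k) (auto intro: F_const F_mult)

lemma F_sum: "(\<And>i. i \<in> I \<Longrightarrow> u i \<in> F) \<Longrightarrow> (\<lambda>x. \<Sum>i\<in>I. u i x) \<in> F"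
  by (induction I rule: infinite_finite_induct) (auto intro: F_const F_add)

lemma F_integrable_fst: "u \<in> F \<Longrightarrow> integrable (P x) (\<lambda>yz. u (fst yz))"
  and F_integrable_snd: "u \<in> F \<Longrightarrow> integrable (P x) (\<lambda>yz. u (snd yz))"
  using F_integrable_tens[of u "\<lambda>_. 1" x] F_integrable_tens[of "\<lambda>_. 1" u x] F_const[of 1] by auto

text \<open>Both \<open>a * g\<close> and \<open>b * h\<close> dominate absolute values, hence are
  nonnegative, so the two bounds can be multiplied pointwise before integrating.\<close>

lemma Ptens_abs_le:
  assumes "u \<in> F" "v \<in> F" "g \<in> F" "h \<in> F"
    and "\<And>x. \<bar>u x\<bar> \<le> a * g x" "\<And>x. \<bar>v x\<bar> \<le> b * h x"
  shows "\<bar>Ptens P u v x\<bar> \<le> a * b * Ptens P g h x"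
proof -
  have "\<bar>u y * v z\<bar> \<le> a * b * (g y * h z)" for y z
    using mult_mono[OF assms(5)[of y] assms(6)[of z]] assms(5)[of y]
    by (simp add: abs_mult mult_ac)
  then have "\<bar>Ptens P u v x\<bar> \<le> (\<integral>yz. a * b * (g (fst yz) * h (snd yz)) \<partial>P x)"
    unfolding Ptens_def
    by (intro integral_abs_bound[THEN order_trans] integral_mono integrable_abs
        integrable_mult_right F_integrable_tens assms) auto
  then show ?thesis by (simp add: Ptens_def)
qed

text \<open>\<open>Q u\<close> is half the sum of \<open>P(u \<otimes> 1)\<close> and
  \<open>P(1 \<otimes> u)\<close>, so conditions (i) and (iii) apply.\<close>

lemma F_Qop: "u \<in> F \<Longrightarrow> Qop P u \<in> F"
proof -
  assume u: "u \<in> F"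
  have "(\<lambda>x. 1/2 * (Ptens P u (\<lambda>_. 1) x + Ptens P (\<lambda>_. 1) u x)) \<in> F"
    by (intro F_scale F_add F_Ptens F_const u)
  then show "Qop P u \<in> F"
    by (simp add: Ptens_def Qop_def[abs_def])
qed

text \<open>The shape \<open>a * u + v\<close> is that of the right side of the moment recursions, a
  multiple of one function plus an error.\<close>

lemma Qop_add:
  assumes "u \<in> F" "v \<in> F"
  shows "Qop P (\<lambda>x. a * u x + v x) = (\<lambda>x. a * Qop P u x + Qop P v x)"
  using assms
  by (auto simp: Qop_def F_integrable_fst F_integrable_snd field_simps)

lemma Qop_mono:
  assumes "u \<in> F" "v \<in> F" "\<And>x. u x \<le> v x"
  shows "Qop P u x \<le> Qop P v x"
  unfolding Qop_def
  by (intro divide_right_mono add_mono integral_mono F_integrable_fst F_integrable_snd assms) auto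

lemma F_Qpow: "u \<in> F \<Longrightarrow> Qpow P s u \<in> F"
  by (induction s) (auto simp: Qpow_def F_Qop)

lemma Qpow_add:
  assumes "u \<in> F" "v \<in> F"
  shows "Qpow P s (\<lambda>x. a * u x + v x) = (\<lambda>x. a * Qpow P s u x + Qpow P s v x)"
  using F_Qpow[OF assms(1)] F_Qpow[OF assms(2)]
  by (induction s) (simp_all add: Qpow_def Qop_add)

lemma Qpow_mono:
  assumes "u \<in> F" "v \<in> F" "\<And>x. u x \<le> v x"
  shows "Qpow P s u x \<le> Qpow P s v x"
proof (induction s arbitrary: x)
  case (Suc s)
  then show ?case
    using Qop_mono[OF F_Qpow[OF assms(1), of s] F_Qpow[OF assms(2), of s]] by (simp add: Qpow_def)
qed (simp add: Qpow_def assms(3))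

lemma Qpow_scale: "u \<in> F \<Longrightarrow> Qpow P s (\<lambda>x. a * u x) = (\<lambda>x. a * Qpow P s u x)"
proof -
  assume u: "u \<in> F"
  have "Qpow P s (\<lambda>_. 0) = (\<lambda>_. 0)"
    by (induction s) (simp_all add: Qpow_def Qop_def)
  then show ?thesis
    using Qpow_add[OF u F_const[of 0]] by simp
qed

text \<open>\<open>Q\<close> is linear and monotone, so the bounds on \<open>u\<close> and on
  \<open>-u\<close> both survive iteration.\<close>

lemma Qpow_abs_le:
  assumes "u \<in> F" "g \<in> F" "\<And>x. \<bar>u x\<bar> \<le> c * g x"
  shows "\<bar>Qpow P s u x\<bar> \<le> c * Qpow P s g x"
proof -
  have "Qpow P s u x \<le> c * Qpow P s g x"
    using Qpow_mono[OF assms(1) F_scale[OF assms(2)], of c s x] assms(3)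
    by (simp add: Qpow_scale[OF assms(2)] abs_le_iff)
  moreover have "- Qpow P s u x \<le> c * Qpow P s g x"
    using Qpow_mono[OF F_scale[OF assms(1), of "-1"] F_scale[OF assms(2)], of c s x] assms(3)
      Qpow_scale[OF assms(1), of s "-1"]
    by (simp add: Qpow_scale[OF assms(2)] abs_le_iff)
  ultimately show ?thesis by simp
qed

text \<open>The factor \<open>2\<close> is the growth of the tree; the induction controls \<open>Q\<^sup>s (v r)\<close> for all \<open>s\<close> at
  once, so that condition (v) is used only for one dominating function.\<close>

lemma affine_recursion_bound:
  assumes v: "\<And>r. v r \<in> F" and e: "\<And>r. e r \<in> F" and h: "h \<in> F"
    and rec: "\<And>r x. v (Suc r) x = 2 * Qop P (v r) x + e r x"
    and bound: "\<And>r x. \<bar>e r x\<bar> \<le> E r * h x" and E: "\<And>r. 0 \<le> E r"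
    and D: "\<And>r. 2^r * (1 + (\<Sum>q<r. E q / 2^q)) \<le> D r"
  shows "\<exists>g\<in>F. \<forall>r x. \<bar>v r x\<bar> \<le> D r * g x"
proof -
  \<comment> \<open>Closure of \<open>F\<close> under absolute values is not among the conditions;
    \<open>1 + t^2\<close> replaces \<open>|t|\<close>. The sum \<open>H\<close> dominates the
    initial value and the error profile \<open>h\<close> together.\<close>
  define H where "H x = (1 + (v 0 x)\<^sup>2) + (1 + (h x)\<^sup>2)" for x
  have H: "H \<in> F"
    unfolding H_def by (intro F_add F_const F_square v h)
  have le_sq: "t \<le> 1 + t\<^sup>2" for t :: real
    using zero_le_power2[of "t - 1/2"] by (simp add: power2_eq_square field_simps)
  have v0: "\<bar>v 0 x\<bar> \<le> 1 * H x" for x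
  proof -
    have "\<bar>v 0 x\<bar> \<le> 1 + (v 0 x)\<^sup>2"
      using le_sq[of "\<bar>v 0 x\<bar>"] by simp
    also have "\<dots> \<le> 1 * H x"
      by (simp add: H_def add_nonneg_nonneg)
    finally show ?thesis .
  qed
  have hH: "h x \<le> H x" for x
  proof -
    have "h x \<le> 1 + (h x)\<^sup>2" by (rule le_sq)
    also have "\<dots> \<le> H x" by (simp add: H_def add_nonneg_nonneg)
    finally show ?thesis .
  qed
  have eH: "\<bar>e r x\<bar> \<le> E r * H x" for r x
    using bound[of r x] mult_left_mono[OF hH[of x] E[of r]] by linarith
  obtain g where g: "g \<in> F" "\<And>s x. \<bar>Qpow P s H x\<bar> \<le> g x"
    using F_Qpow_bound[OF H] by blast
  have "\<bar>Qpow P s (v r) x\<bar> \<le> 2^r * (1 + (\<Sum>q<r. E q / 2^q)) * g x" for s r x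
  proof (induction r arbitrary: s)
    case 0
    then show ?case
      using Qpow_abs_le[OF v H v0, of s x] g(2)[of s x] by simp
  next
    case (Suc r)
    have Qv: "Qop P (v r) \<in> F" by (rule F_Qop[OF v])
    have vS: "v (Suc r) = (\<lambda>x. 2 * Qop P (v r) x + e r x)"
      using rec by auto
    have "Qpow P s (Qop P (v r)) = Qpow P (Suc s) (v r)"
      by (simp add: Qpow_def funpow_swap1)
    then have eq: "Qpow P s (v (Suc r)) x = 2 * Qpow P (Suc s) (v r) x + Qpow P s (e r) x"
      unfolding vS by (simp add: Qpow_add[OF Qv e])
    have "\<bar>Qpow P s (e r) x\<bar> \<le> E r * Qpow P s H x"
      by (rule Qpow_abs_le[OF e H eH])
    also have "\<dots> \<le> E r * g x"
      using g(2)[of s x] by (intro mult_left_mono E) linarith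
    \<comment> \<open>The doubling is a deliberate loss: the new summand of the closed form is
      \<open>2^(r+1) * (E r / 2^r) = 2 * E r\<close>.\<close>
    also have "\<dots> \<le> 2 * (E r * g x)"
      using E[of r] g(2)[of s x] by auto
    finally have "\<bar>Qpow P s (v (Suc r)) x\<bar>
        \<le> 2 * (2^r * (1 + (\<Sum>q<r. E q / 2^q)) * g x) + 2 * (E r * g x)"
      using Suc.IH[of "Suc s"] unfolding eq by linarith
    also have "\<dots> = 2^Suc r * (1 + (\<Sum>q<Suc r. E q / 2^q)) * g x"
      by (simp add: field_simps)
    finally show ?case .
  qed
  from this[of 0] have v_le: "\<bar>v r x\<bar> \<le> 2^r * (1 + (\<Sum>q<r. E q / 2^q)) * g x" for r x
    by (simp add: Qpow_def)
  \<comment> \<open>At \<open>r = 0\<close> the sum is empty and \<open>g\<close> dominates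
    \<open>|v 0|\<close>; this sign is what permits replacing the closed form by
    \<open>D r\<close>.\<close>
  have "0 \<le> g x" for x
    using v_le[of 0 x] by simp
  then show ?thesis
    using order_trans[OF v_le mult_right_mono[OF D]] g(1) by blast
qed

section \<open>The branching property for unbounded functions\<close>

lemma prob_space_M: "prob_space M"
  and X_measurable: "1 \<le> n \<Longrightarrow> X n \<in> M \<rightarrow>\<^sub>M borel"
  and distr_root: "distr M borel (X 1) = \<nu>"
  and P_measurable: "P \<in> borel \<rightarrow>\<^sub>M subprob_algebra (borel \<Otimes>\<^sub>M borel)"
  and prob_space_P: "prob_space (P x)"
  using bmc unfolding bifurcating_MC_def T_transition_def by blast+

lemma sets_P: "sets (P x) = sets (borel \<Otimes>\<^sub>M borel)"
  using measurable_space[OF P_measurable, of x] by (auto simp: space_subprob_algebra)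

lemma Gen_ge_1: "n \<in> Gen r \<Longrightarrow> 1 \<le> n"
  unfolding Gen_def by (auto intro: order_trans[OF one_le_power[of 2 r]])

lemma finite_Gen: "finite (Gen r)"
  by (simp add: Gen_def)

lemma Filt_subalgebra: "subalgebra M (Filt M X r)"
proof -
  have "{X i -` A \<inter> space M | i A. i \<in> Tr r \<and> A \<in> sets borel} \<subseteq> sets M"
    using Gen_ge_1 X_measurable by (auto simp: Tr_def intro!: measurable_sets[of _ M borel])
  then have "sigma_sets (space M) {X i -` A \<inter> space M | i A. i \<in> Tr r \<and> A \<in> sets borel} \<subseteq> sets M"
    by (rule sets.sigma_sets_subset)
  then show ?thesis
    by (auto simp: subalgebra_def Filt_def space_measure_of_conv sets_measure_of_conv)
qed

text \<open>Integrating the branching property removes the conditioning, since conditional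
  expectation preserves the integral.\<close>

lemma expectation_prod_bounded:
  fixes H :: "nat \<Rightarrow> 'a \<times> 'a \<Rightarrow> real"
  assumes H[measurable]: "\<And>n. n \<in> Gen r \<Longrightarrow> H n \<in> borel_measurable (borel \<Otimes>\<^sub>M borel)"
    and B: "\<And>n t. n \<in> Gen r \<Longrightarrow> \<bar>H n t\<bar> \<le> B"
  shows "integrable M (\<lambda>\<omega>. \<Prod>n\<in>Gen r. H n (X (2*n) \<omega>, X (2*n+1) \<omega>))"
    and "(\<integral>\<omega>. (\<Prod>n\<in>Gen r. H n (X (2*n) \<omega>, X (2*n+1) \<omega>)) \<partial>M)
       = (\<integral>\<omega>. (\<Prod>n\<in>Gen r. integral\<^sup>L (P (X n \<omega>)) (H n)) \<partial>M)"
proof -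
  interpret prob_space M by (rule prob_space_M)
  interpret finite_measure_subalgebra M "Filt M X r"
    by standard (rule Filt_subalgebra)
  note P_measurable[measurable]
  have [measurable]: "X n \<in> M \<rightarrow>\<^sub>M borel" "X (2*n) \<in> M \<rightarrow>\<^sub>M borel" "X (2*n+1) \<in> M \<rightarrow>\<^sub>M borel"
      "X (Suc (2*n)) \<in> M \<rightarrow>\<^sub>M borel"
    if "n \<in> Gen r" for n
    using Gen_ge_1[OF that] by (auto intro: X_measurable)
  let ?L = "\<lambda>\<omega>. \<Prod>n\<in>Gen r. H n (X (2*n) \<omega>, X (2*n+1) \<omega>)"
  let ?R = "\<lambda>\<omega>. \<Prod>n\<in>Gen r. integral\<^sup>L (P (X n \<omega>)) (H n)"
  have [measurable]: "?L \<in> borel_measurable M"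
    by measurable
  show int: "integrable M ?L"
  proof (rule integrable_const_bound[where B="\<Prod>n\<in>Gen r. B"])
    have "\<bar>?L \<omega>\<bar> \<le> (\<Prod>n\<in>Gen r. B)" for \<omega>
      unfolding abs_prod by (rule prod_mono) (auto simp: B)
    then show "AE \<omega> in M. norm (?L \<omega>) \<le> (\<Prod>n\<in>Gen r. B)" by simp
  qed measurable
  have [measurable]: "?R \<in> borel_measurable M"
    by measurable
  \<comment> \<open>Composing with \<open>snd\<close> drops the mother from the triple (mother,
    daughters), so \<open>Pop\<close> becomes the plain integral of \<open>H n\<close> under
    \<open>P\<close>.\<close>
  have "\<forall>n\<in>Gen r. (\<lambda>t. H n (snd t)) \<in> borel_measurable (borel \<Otimes>\<^sub>M borel \<Otimes>\<^sub>M borel) \<and>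
      (\<exists>B. \<forall>t::'a\<times>'a\<times>'a. \<bar>H n (snd t)\<bar> \<le> B)"
    using B by (auto intro!: measurable_compose[OF measurable_snd H])
  then have "AE \<omega> in M. real_cond_exp M (Filt M X r)
              (\<lambda>\<omega>. \<Prod>n\<in>Gen r. H n (snd (X n \<omega>, X (2*n) \<omega>, X (2*n+1) \<omega>))) \<omega>
           = (\<Prod>n\<in>Gen r. Pop P (\<lambda>t. H n (snd t)) (X n \<omega>))"
    using bmc unfolding bifurcating_MC_def by (auto elim!: allE[where x=r] allE[where x="\<lambda>n t. H n (snd t)"])
  then have "AE \<omega> in M. real_cond_exp M (Filt M X r) ?L \<omega> = ?R \<omega>"
    by (simp add: Pop_def)
  then have "(\<integral>\<omega>. real_cond_exp M (Filt M X r) ?L \<omega> \<partial>M) = integral\<^sup>L M ?R"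
    by (intro integral_cong_AE) auto
  then show "integral\<^sup>L M ?L = integral\<^sup>L M ?R"
    using real_cond_exp_int(2)[OF int] by simp
qed

text \<open>The branching property is only given for bounded functions; truncating \<open>U\<close> and using monotone
  convergence gives integrability, then truncating \<open>H\<close> and using dominated convergence on both
  sides gives the identity.\<close>

lemma expectation_prod:
  fixes H U :: "nat \<Rightarrow> 'a \<times> 'a \<Rightarrow> real"
  assumes H: "\<And>n. n \<in> Gen r \<Longrightarrow> H n \<in> borel_measurable (borel \<Otimes>\<^sub>M borel)"
    and U: "\<And>n. n \<in> Gen r \<Longrightarrow> U n \<in> borel_measurable (borel \<Otimes>\<^sub>M borel)"
    and HU: "\<And>n t. n \<in> Gen r \<Longrightarrow> \<bar>H n t\<bar> \<le> U n t"
    and U_P: "\<And>n x. n \<in> Gen r \<Longrightarrow> integrable (P x) (U n)"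
    and U_M: "integrable M (\<lambda>\<omega>. \<Prod>n\<in>Gen r. integral\<^sup>L (P (X n \<omega>)) (U n))"
  shows "integrable M (\<lambda>\<omega>. \<Prod>n\<in>Gen r. H n (X (2*n) \<omega>, X (2*n+1) \<omega>))" (is ?A)
    and "(\<integral>\<omega>. (\<Prod>n\<in>Gen r. H n (X (2*n) \<omega>, X (2*n+1) \<omega>)) \<partial>M)
       = (\<integral>\<omega>. (\<Prod>n\<in>Gen r. integral\<^sup>L (P (X n \<omega>)) (H n)) \<partial>M)" (is ?B)
proof -
  note P_measurable[measurable] H[measurable] U[measurable]
  have [measurable]: "X n \<in> M \<rightarrow>\<^sub>M borel" "X (2*n) \<in> M \<rightarrow>\<^sub>M borel" "X (2*n+1) \<in> M \<rightarrow>\<^sub>M borel"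
      "X (Suc (2*n)) \<in> M \<rightarrow>\<^sub>M borel"
    if "n \<in> Gen r" for n
    using Gen_ge_1[OF that] by (auto intro: X_measurable)
  let ?Y = "\<lambda>n \<omega>. (X (2*n) \<omega>, X (2*n+1) \<omega>)"
  let ?T = "\<lambda>G k n t. max (- real k) (min (real k) (G n t))"
  have U0: "0 \<le> U n t" if "n \<in> Gen r" for n t
    using HU[OF that, of t] by linarith
  have mP: "g \<in> borel_measurable (P x)" if "g \<in> borel_measurable (borel \<Otimes>\<^sub>M borel)" for g :: "'a \<times> 'a \<Rightarrow> real" and x
    using that by (simp add: measurable_cong_sets[OF sets_P refl])
  have bdd: "\<bar>?T G k n t\<bar> \<le> real k" for G :: "nat \<Rightarrow> 'a \<times> 'a \<Rightarrow> real" and k n t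
    by auto
  have lim_T: "(\<lambda>k. ?T G k n t) \<longlonglongrightarrow> G n t" for G :: "nat \<Rightarrow> 'a \<times> 'a \<Rightarrow> real" and n t
  proof (rule tendsto_eventually)
    obtain k0 where "\<bar>G n t\<bar> \<le> real k0" using real_arch_simple by blast
    then show "\<forall>\<^sub>F k in sequentially. ?T G k n t = G n t"
      by (intro eventually_sequentiallyI[of k0]) auto
  qed
  have T_le: "\<bar>?T H k n t\<bar> \<le> U n t" if "n \<in> Gen r" for k n t
    using HU[OF that, of t] by auto
  have TU0: "0 \<le> ?T U k n t" "?T U k n t \<le> U n t" if "n \<in> Gen r" for k n t
    using U0[OF that, of t] by auto
  have TU_mono: "?T U k n t \<le> ?T U l n t" if "n \<in> Gen r" "k \<le> l" for k l n t
    using U0[OF that(1), of t] that(2) by auto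
  have T_meas: "?T G k n \<in> borel_measurable (borel \<Otimes>\<^sub>M borel)"
    if "G n \<in> borel_measurable (borel \<Otimes>\<^sub>M borel)" for G :: "nat \<Rightarrow> 'a \<times> 'a \<Rightarrow> real" and k n
    using that by measurable
  have TE_int: "integrable M (\<lambda>\<omega>. \<Prod>n\<in>Gen r. ?T G k n (?Y n \<omega>))"
    and TE_eq: "(\<integral>\<omega>. (\<Prod>n\<in>Gen r. ?T G k n (?Y n \<omega>)) \<partial>M)
      = (\<integral>\<omega>. (\<Prod>n\<in>Gen r. integral\<^sup>L (P (X n \<omega>)) (?T G k n)) \<partial>M)"
    if "\<And>n. n \<in> Gen r \<Longrightarrow> G n \<in> borel_measurable (borel \<Otimes>\<^sub>M borel)" for G k
    by (rule expectation_prod_bounded[where B="real k"], rule T_meas, erule that, rule bdd)+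
  have PU_int: "integrable (P x) (?T U k n)" if "n \<in> Gen r" for x k n
  proof (rule Bochner_Integration.integrable_bound[OF U_P[OF that]])
    show "?T U k n \<in> borel_measurable (P x)"
      by (intro mP T_meas U that)
    show "AE t in P x. norm (?T U k n t) \<le> norm (U n t)"
      using TU0[OF that] U0[OF that] by (intro AE_I2) (simp only: real_norm_def abs_of_nonneg)
  qed
  let ?c = "\<integral>\<omega>. (\<Prod>n\<in>Gen r. integral\<^sup>L (P (X n \<omega>)) (U n)) \<partial>M"
  let ?I = "\<lambda>k. \<integral>\<omega>. (\<Prod>n\<in>Gen r. ?T U k n (?Y n \<omega>)) \<partial>M"
  \<comment> \<open>The bounded case moves the integral to the mothers, where \<open>U_M\<close>
    gives a bound independent of \<open>k\<close>. With monotonicity in \<open>k\<close> this makes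
    the integrals converge, as monotone convergence requires.\<close>
  have I_le: "?I k \<le> ?c" for k
  proof -
    have "?I k = (\<integral>\<omega>. (\<Prod>n\<in>Gen r. integral\<^sup>L (P (X n \<omega>)) (?T U k n)) \<partial>M)"
      by (rule TE_eq) (rule U)
    also have "\<dots> \<le> ?c"
    proof (rule integral_mono')
      show "integrable M (\<lambda>\<omega>. \<Prod>n\<in>Gen r. integral\<^sup>L (P (X n \<omega>)) (U n))" by (rule U_M)
      show "(\<Prod>n\<in>Gen r. integral\<^sup>L (P (X n \<omega>)) (?T U k n)) \<le> (\<Prod>n\<in>Gen r. integral\<^sup>L (P (X n \<omega>)) (U n))" for \<omega>
        using TU0 by (intro prod_mono conjI integral_nonneg integral_mono PU_int U_P) auto
      show "0 \<le> (\<Prod>n\<in>Gen r. integral\<^sup>L (P (X n \<omega>)) (U n))" for \<omega>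
        using U0 by (intro prod_nonneg integral_nonneg) auto
    qed
    finally show ?thesis .
  qed
  have prod_mono_T: "(\<Prod>n\<in>Gen r. ?T U k n (?Y n \<omega>)) \<le> (\<Prod>n\<in>Gen r. ?T U l n (?Y n \<omega>))"
    if "k \<le> l" for k l \<omega>
    using that by (intro prod_mono conjI TU0 TU_mono) auto
  have "incseq ?I"
    by (intro monoI integral_mono TE_int U prod_mono_T)
  then obtain L where L: "?I \<longlonglongrightarrow> L"
    using incseq_convergent[of ?I ?c] I_le by blast
  have U_int: "integrable M (\<lambda>\<omega>. \<Prod>n\<in>Gen r. U n (?Y n \<omega>))"
  proof (rule integrable_monotone_convergence[OF _ _ _ L])
    show "integrable M (\<lambda>\<omega>. \<Prod>n\<in>Gen r. ?T U k n (?Y n \<omega>))" for k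
      by (rule TE_int) (rule U)
    show "AE \<omega> in M. mono (\<lambda>k. \<Prod>n\<in>Gen r. ?T U k n (?Y n \<omega>))"
      by (intro AE_I2 monoI prod_mono_T)
    show "AE \<omega> in M. (\<lambda>k. \<Prod>n\<in>Gen r. ?T U k n (?Y n \<omega>)) \<longlonglongrightarrow> (\<Prod>n\<in>Gen r. U n (?Y n \<omega>))"
      by (intro AE_I2 tendsto_prod lim_T)
  qed measurable
  have meas_L: "(\<lambda>\<omega>. \<Prod>n\<in>Gen r. H n (?Y n \<omega>)) \<in> borel_measurable M"
    by measurable
  have meas_R: "(\<lambda>\<omega>. \<Prod>n\<in>Gen r. integral\<^sup>L (P (X n \<omega>)) (H n)) \<in> borel_measurable M"
    by measurable
  have dom: "\<bar>\<Prod>n\<in>Gen r. G n\<bar> \<le> (\<Prod>n\<in>Gen r. V n)" if "\<And>n. n \<in> Gen r \<Longrightarrow> \<bar>G n\<bar> \<le> V n"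
    for G V :: "nat \<Rightarrow> real"
    unfolding abs_prod by (intro prod_mono conjI that) auto
  show ?A
  proof (rule Bochner_Integration.integrable_bound[OF U_int meas_L])
    show "AE \<omega> in M. norm (\<Prod>n\<in>Gen r. H n (?Y n \<omega>)) \<le> norm (\<Prod>n\<in>Gen r. U n (?Y n \<omega>))"
      using dom[OF HU] by (intro AE_I2) (fastforce intro: order_trans)
  qed
  have "(\<lambda>k. \<integral>\<omega>. (\<Prod>n\<in>Gen r. ?T H k n (?Y n \<omega>)) \<partial>M) \<longlonglongrightarrow> (\<integral>\<omega>. (\<Prod>n\<in>Gen r. H n (?Y n \<omega>)) \<partial>M)"
  proof (rule integral_dominated_convergence[where w="\<lambda>\<omega>. \<Prod>n\<in>Gen r. U n (?Y n \<omega>)"])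
    show "(\<lambda>\<omega>. \<Prod>n\<in>Gen r. ?T H k n (?Y n \<omega>)) \<in> borel_measurable M" for k
      by measurable
    show "AE \<omega> in M. (\<lambda>k. \<Prod>n\<in>Gen r. ?T H k n (?Y n \<omega>)) \<longlonglongrightarrow> (\<Prod>n\<in>Gen r. H n (?Y n \<omega>))"
      by (intro AE_I2 tendsto_prod lim_T)
    show "AE \<omega> in M. norm (\<Prod>n\<in>Gen r. ?T H k n (?Y n \<omega>)) \<le> (\<Prod>n\<in>Gen r. U n (?Y n \<omega>))" for k
      unfolding real_norm_def by (intro AE_I2 dom T_le)
  qed (fact meas_L U_int)+
  moreover have "(\<lambda>k. \<integral>\<omega>. (\<Prod>n\<in>Gen r. integral\<^sup>L (P (X n \<omega>)) (?T H k n)) \<partial>M)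
      \<longlonglongrightarrow> (\<integral>\<omega>. (\<Prod>n\<in>Gen r. integral\<^sup>L (P (X n \<omega>)) (H n)) \<partial>M)"
  proof (rule integral_dominated_convergence[where w="\<lambda>\<omega>. \<Prod>n\<in>Gen r. integral\<^sup>L (P (X n \<omega>)) (U n)"])
    show "(\<lambda>\<omega>. \<Prod>n\<in>Gen r. integral\<^sup>L (P (X n \<omega>)) (?T H k n)) \<in> borel_measurable M" for k
      by measurable
    \<comment> \<open>Convergence on this side is nested: first inside each \<open>P x\<close> with
      dominating function \<open>U n\<close>, then under \<open>M\<close> with the product of the
      integrals of the \<open>U n\<close>.\<close>
    have "(\<lambda>k. integral\<^sup>L (P x) (?T H k n)) \<longlonglongrightarrow> integral\<^sup>L (P x) (H n)" if "n \<in> Gen r" for n x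
      by (rule integral_dominated_convergence[where w="U n"])
         (use that in \<open>auto intro!: mP T_meas H U_P lim_T AE_I2 simp: T_le\<close>)
    then show "AE \<omega> in M. (\<lambda>k. \<Prod>n\<in>Gen r. integral\<^sup>L (P (X n \<omega>)) (?T H k n))
        \<longlonglongrightarrow> (\<Prod>n\<in>Gen r. integral\<^sup>L (P (X n \<omega>)) (H n))"
      by (intro AE_I2 tendsto_prod)
    have "\<bar>integral\<^sup>L (P x) (?T H k n)\<bar> \<le> integral\<^sup>L (P x) (U n)" if "n \<in> Gen r" for n x k
      by (intro integral_abs_bound[THEN order_trans] integral_mono_AE' AE_I2 U_P abs_ge_zero T_le U0 that)
    then show "AE \<omega> in M. norm (\<Prod>n\<in>Gen r. integral\<^sup>L (P (X n \<omega>)) (?T H k n))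
        \<le> (\<Prod>n\<in>Gen r. integral\<^sup>L (P (X n \<omega>)) (U n))" for k
      unfolding real_norm_def by (intro AE_I2 dom)
  qed (fact meas_R U_M)+
  moreover have "(\<integral>\<omega>. (\<Prod>n\<in>Gen r. ?T H k n (?Y n \<omega>)) \<partial>M)
      = (\<integral>\<omega>. (\<Prod>n\<in>Gen r. integral\<^sup>L (P (X n \<omega>)) (?T H k n)) \<partial>M)" for k
    by (rule TE_eq) (rule H)
  ultimately show ?B
    using LIMSEQ_unique by simp
qed

section \<open>Products over a generation and generating functions\<close>

lemma Gen_0: "Gen 0 = {1}"
  by (auto simp: Gen_def)

lemma card_Gen: "card (Gen r) = 2^r"
  by (simp add: Gen_def)

lemma daughters_in_Gen: "n \<in> Gen r \<Longrightarrow> 2 * n \<in> Gen (Suc r) \<and> Suc (2 * n) \<in> Gen (Suc r)"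
  by (auto simp: Gen_def)

text \<open>Each vertex \<open>m\<close> of the next generation is an even or odd daughter of
  \<open>m div 2\<close>. Grouping by mothers gives the form to which the branching property
  applies.\<close>

lemma prod_Gen_Suc:
  fixes g :: "nat \<Rightarrow> 'c::comm_monoid_mult"
  shows "(\<Prod>n\<in>Gen (Suc r). g n) = (\<Prod>n\<in>Gen r. g (2*n) * g (Suc (2*n)))"
proof -
  have "Gen (Suc r) = (\<lambda>n. 2*n) ` Gen r \<union> (\<lambda>n. Suc (2*n)) ` Gen r"
  proof (intro equalityI subsetI)
    fix m assume m: "m \<in> Gen (Suc r)"
    then have "m div 2 \<in> Gen r" by (auto simp: Gen_def)
    moreover have "m = 2 * (m div 2) \<or> m = Suc (2 * (m div 2))" by arith
    ultimately show "m \<in> (\<lambda>n. 2*n) ` Gen r \<union> (\<lambda>n. Suc (2*n)) ` Gen r" by blast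
  qed (use daughters_in_Gen in auto)
  moreover have "(\<lambda>n. 2*n) ` Gen r \<inter> (\<lambda>n. Suc (2*n)) ` Gen r = {}"
    by auto presburger
  ultimately show ?thesis
    by (simp add: prod.union_disjoint finite_Gen prod.reindex inj_on_def prod.distrib)
qed

text \<open>The hypothesis \<open>int\<close> is \<open>integrable_prod\<close> below, whose induction step uses this lemma.\<close>

lemma expectation_prod_sum_tens:
  fixes I :: "nat \<Rightarrow> 'i set"
  assumes a: "\<And>n i. n \<in> Gen r \<Longrightarrow> i \<in> I n \<Longrightarrow> a n i \<in> F"
    and b: "\<And>n i. n \<in> Gen r \<Longrightarrow> i \<in> I n \<Longrightarrow> b n i \<in> F"
    and int: "\<And>u. (\<And>n. n \<in> Gen r \<Longrightarrow> u n \<in> F) \<Longrightarrow> integrable M (\<lambda>\<omega>. \<Prod>n\<in>Gen r. u n (X n \<omega>))"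
  shows "integrable M (\<lambda>\<omega>. \<Prod>n\<in>Gen r. \<Sum>i\<in>I n. a n i (X (2*n) \<omega>) * b n i (X (Suc (2*n)) \<omega>))"
    and "(\<integral>\<omega>. (\<Prod>n\<in>Gen r. \<Sum>i\<in>I n. a n i (X (2*n) \<omega>) * b n i (X (Suc (2*n)) \<omega>)) \<partial>M)
       = (\<integral>\<omega>. (\<Prod>n\<in>Gen r. \<Sum>i\<in>I n. Ptens P (a n i) (b n i) (X n \<omega>)) \<partial>M)"
proof -
  \<comment> \<open>A single tensor product of functions in \<open>F\<close> dominates the whole sum
    of tensor products: \<open>|p q| \<le> p^2 + q^2\<close> and
    \<open>S + T \<le> (1 + S) (1 + T)\<close>. Its image under \<open>P\<close> is again in
    \<open>F\<close>, so \<open>int\<close> applies to it.\<close>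
  let ?A = "\<lambda>n y. 1 + (\<Sum>i\<in>I n. (a n i y)\<^sup>2)"
  let ?B = "\<lambda>n z. 1 + (\<Sum>i\<in>I n. (b n i z)\<^sup>2)"
  let ?H = "\<lambda>n yz. \<Sum>i\<in>I n. a n i (fst yz) * b n i (snd yz)"
  let ?U = "\<lambda>n yz. ?A n (fst yz) * ?B n (snd yz)"
  have AF: "?A n \<in> F" and BF: "?B n \<in> F" if "n \<in> Gen r" for n
    using that by (auto intro!: F_add F_const F_sum F_square a b)
  have tens_meas: "(\<lambda>yz. u (fst yz) * v (snd yz)) \<in> borel_measurable (borel \<Otimes>\<^sub>M borel)"
    if "u \<in> F" "v \<in> F" for u v
    using F_measurable[OF that(1)] F_measurable[OF that(2)] by measurable
  have H_meas: "?H n \<in> borel_measurable (borel \<Otimes>\<^sub>M borel)" if "n \<in> Gen r" for n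
    by (intro borel_measurable_sum tens_meas a b that)
  have U_meas: "?U n \<in> borel_measurable (borel \<Otimes>\<^sub>M borel)" if "n \<in> Gen r" for n
    by (intro tens_meas AF BF that)
  have HU: "\<bar>?H n t\<bar> \<le> ?U n t" for n t
  proof -
    let ?S = "\<Sum>i\<in>I n. (a n i (fst t))\<^sup>2" and ?T = "\<Sum>i\<in>I n. (b n i (snd t))\<^sup>2"
    have "\<bar>p * q\<bar> \<le> p\<^sup>2 + q\<^sup>2" for p q :: real
      using sum_squares_bound[of "\<bar>p\<bar>" "\<bar>q\<bar>"] mult_nonneg_nonneg[of "\<bar>p\<bar>" "\<bar>q\<bar>"]
      unfolding abs_mult power2_abs by linarith
    then have "\<bar>?H n t\<bar> \<le> (\<Sum>i\<in>I n. (a n i (fst t))\<^sup>2 + (b n i (snd t))\<^sup>2)"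
      by (intro sum_abs[THEN order_trans] sum_mono)
    also have "\<dots> = ?S + ?T" by (rule sum.distrib)
    also have "\<dots> \<le> (1 + ?S) * (1 + ?T)"
      using mult_nonneg_nonneg[of ?S ?T] by (simp add: sum_nonneg algebra_simps)
    finally show ?thesis .
  qed
  have U_int: "integrable (P x) (?U n)" if "n \<in> Gen r" for n x
    by (intro F_integrable_tens AF BF that)
  have "integrable M (\<lambda>\<omega>. \<Prod>n\<in>Gen r. Ptens P (?A n) (?B n) (X n \<omega>))"
    by (rule int) (intro F_Ptens AF BF)
  then have M_int: "integrable M (\<lambda>\<omega>. \<Prod>n\<in>Gen r. integral\<^sup>L (P (X n \<omega>)) (?U n))"
    by (simp add: Ptens_def)
  have H_int: "integral\<^sup>L (P x) (?H n) = (\<Sum>i\<in>I n. Ptens P (a n i) (b n i) x)" if "n \<in> Gen r" for n x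
    unfolding Ptens_def by (intro Bochner_Integration.integral_sum F_integrable_tens a b that)
  note * = expectation_prod[of r ?H ?U, OF H_meas U_meas HU U_int M_int]
  show "integrable M (\<lambda>\<omega>. \<Prod>n\<in>Gen r. \<Sum>i\<in>I n. a n i (X (2*n) \<omega>) * b n i (X (Suc (2*n)) \<omega>))"
    using *(1) by simp
  have "(\<integral>\<omega>. (\<Prod>n\<in>Gen r. ?H n (X (2*n) \<omega>, X (Suc (2*n)) \<omega>)) \<partial>M)
       = (\<integral>\<omega>. (\<Prod>n\<in>Gen r. integral\<^sup>L (P (X n \<omega>)) (?H n)) \<partial>M)"
    using *(2) by simp
  also have "\<dots> = (\<integral>\<omega>. (\<Prod>n\<in>Gen r. \<Sum>i\<in>I n. Ptens P (a n i) (b n i) (X n \<omega>)) \<partial>M)"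
    by (intro Bochner_Integration.integral_cong prod.cong refl H_int)
  finally show "(\<integral>\<omega>. (\<Prod>n\<in>Gen r. \<Sum>i\<in>I n. a n i (X (2*n) \<omega>) * b n i (X (Suc (2*n)) \<omega>)) \<partial>M)
       = (\<integral>\<omega>. (\<Prod>n\<in>Gen r. \<Sum>i\<in>I n. Ptens P (a n i) (b n i) (X n \<omega>)) \<partial>M)"
    by simp
qed

lemma integrable_root:
  assumes "u \<in> F"
  shows "integrable M (\<lambda>\<omega>. u (X 1 \<omega>))" "(\<integral>\<omega>. u (X 1 \<omega>) \<partial>M) = integral\<^sup>L \<nu> u"
  using F_integrable[OF assms] unfolding distr_root[symmetric]
  by (auto intro!: integrable_distr[OF X_measurable] integral_distr[symmetric] X_measurable
      F_measurable[OF assms])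

text \<open>Induction on the generation with \<open>u\<close> arbitrary: integrability one
  generation earlier, for the functions obtained through \<open>P\<close>, carries over to the
  daughters.\<close>

lemma integrable_prod:
  "(\<And>n. n \<in> Gen r \<Longrightarrow> u n \<in> F) \<Longrightarrow> integrable M (\<lambda>\<omega>. \<Prod>n\<in>Gen r. u n (X n \<omega>))"
proof (induction r arbitrary: u)
  case 0
  then show ?case
    using integrable_root(1)[of "u 1"] by (simp add: Gen_0)
next
  case (Suc r)
  show ?case
    \<comment> \<open>The one-point index set reduces the inner sum to one tensor product.\<close>
    using expectation_prod_sum_tens(1)[of r "\<lambda>_. {()}" "\<lambda>n _. u (2*n)" "\<lambda>n _. u (Suc (2*n))"]
      Suc daughters_in_Gen
    by (simp add: prod_Gen_Suc)
qed

text \<open>Encoding the moments \<open>f\<^sup>k/k!\<close> at one vertex as the coefficients of the formal power series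
  \<open>exp(t f)\<close> turns the sum over a generation into a product over its vertices, to which the
  branching property applies coefficientwise.\<close>

definition branch :: "(nat \<Rightarrow> 'a \<Rightarrow> real) \<Rightarrow> nat \<Rightarrow> 'a \<Rightarrow> real" where
  "branch w k x = (\<Sum>i=0..k. Ptens P (w i) (w (k - i)) x)"

lemma F_branch: "(\<And>k. w k \<in> F) \<Longrightarrow> branch w k \<in> F"
  unfolding branch_def[abs_def] by (intro F_sum F_Ptens)

text \<open>A coefficient of the product is a finite sum, over all ways of distributing the degree
  \<open>j\<close> among the vertices, of products of functions in \<open>F\<close>.\<close>

lemma integrable_fps_prod_nth:
  assumes "\<And>k. w k \<in> F"
  shows "integrable M (\<lambda>\<omega>. fps_nth (\<Prod>n\<in>Gen r. Abs_fps (\<lambda>k. w k (X n \<omega>))) j)"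
  unfolding fps_prod_nth'[OF finite_Gen] fps_nth_Abs_fps
  by (intro Bochner_Integration.integrable_sum integrable_prod assms)

text \<open>Multiplying the series of two sisters gives a Cauchy product, and
  \<open>branch w k\<close> is the \<open>P\<close>-average of its coefficient of degree
  \<open>k\<close>.\<close>

lemma expectation_fps_prod_Suc:
  assumes w: "\<And>k. w k \<in> F"
  shows "(\<integral>\<omega>. fps_nth (\<Prod>n\<in>Gen (Suc r). Abs_fps (\<lambda>k. w k (X n \<omega>))) j \<partial>M)
       = (\<integral>\<omega>. fps_nth (\<Prod>n\<in>Gen r. Abs_fps (\<lambda>k. branch w k (X n \<omega>))) j \<partial>M)"
proof -
  \<comment> \<open>A multiset \<open>K\<close> distributes the total degree \<open>j\<close>;
    \<open>count K n\<close> is the share of vertex \<open>n\<close>.\<close>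
  let ?C = "multisets_of_size (Gen r) j"
  have "fps_nth (\<Prod>n\<in>Gen (Suc r). Abs_fps (\<lambda>k. w k (X n \<omega>))) j
      = (\<Sum>K\<in>?C. \<Prod>n\<in>Gen r. \<Sum>i\<in>{0..count K n}. w i (X (2*n) \<omega>) * w (count K n - i) (X (Suc (2*n)) \<omega>))" for \<omega>
    by (simp add: prod_Gen_Suc fps_prod_nth'[OF finite_Gen] fps_mult_nth)
  then have "(\<integral>\<omega>. fps_nth (\<Prod>n\<in>Gen (Suc r). Abs_fps (\<lambda>k. w k (X n \<omega>))) j \<partial>M)
      = (\<Sum>K\<in>?C. \<integral>\<omega>. (\<Prod>n\<in>Gen r. \<Sum>i\<in>{0..count K n}. w i (X (2*n) \<omega>) * w (count K n - i) (X (Suc (2*n)) \<omega>)) \<partial>M)"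
    by (simp only:, intro Bochner_Integration.integral_sum expectation_prod_sum_tens(1) integrable_prod w)
  also have "\<dots> = (\<Sum>K\<in>?C. \<integral>\<omega>. (\<Prod>n\<in>Gen r. branch w (count K n) (X n \<omega>)) \<partial>M)"
    unfolding branch_def
    by (intro sum.cong refl expectation_prod_sum_tens(2) integrable_prod w)
  also have "\<dots> = (\<integral>\<omega>. (\<Sum>K\<in>?C. \<Prod>n\<in>Gen r. branch w (count K n) (X n \<omega>)) \<partial>M)"
    by (intro Bochner_Integration.integral_sum[symmetric] integrable_prod F_branch w)
  finally show ?thesis
    by (simp add: fps_prod_nth'[OF finite_Gen])
qed

text \<open>Each generation removed applies \<open>branch\<close> once, until only the root, of law
  \<open>\<nu>\<close>, remains. The coefficients change at each step, so \<open>w\<close> is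
  arbitrary in the induction.\<close>

lemma expectation_fps_prod:
  "(\<And>k. w k \<in> F) \<Longrightarrow> (\<integral>\<omega>. fps_nth (\<Prod>n\<in>Gen r. Abs_fps (\<lambda>k. w k (X n \<omega>))) j \<partial>M)
     = integral\<^sup>L \<nu> ((branch ^^ r) w j)"
proof (induction r arbitrary: w)
  case 0
  then show ?case
    using integrable_root(2)[of "w j"] by (simp add: Gen_0)
next
  case (Suc r)
  then show ?case
    using expectation_fps_prod_Suc[of w r j] F_branch by (simp add: funpow_Suc_right del: funpow.simps)
qed

text \<open>The function \<open>x \<mapsto> E_x[S_r^k] / k!\<close> of the overview, obtained by
  iterating \<open>branch\<close>, so that no chain started at a given point has to be
  constructed.\<close>

definition mom :: "('a \<Rightarrow> real) \<Rightarrow> nat \<Rightarrow> nat \<Rightarrow> 'a \<Rightarrow> real" where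
  "mom f r = (branch ^^ r) (\<lambda>k x. f x ^ k / fact k)"

lemma F_mom:
  assumes f: "f \<in> F"
  shows "mom f r k \<in> F"
proof (induction r arbitrary: k)
  case 0
  have "(\<lambda>x. (1 / fact k) * f x ^ k) \<in> F"
    by (intro F_scale F_power f)
  then show ?case by (simp add: mom_def)
next
  case (Suc r)
  then show ?case
    using F_branch[of "mom f r"] by (simp add: mom_def)
qed

lemma fps_exp_sum:
  fixes c :: "'b \<Rightarrow> real"
  shows "finite A \<Longrightarrow> fps_exp (\<Sum>n\<in>A. c n) = (\<Prod>n\<in>A. fps_exp (c n))"
  by (induction rule: finite_induct) (simp_all add: fps_exp_add_mult)

text \<open>The coefficient of degree \<open>j\<close> of \<open>fps_exp S\<close> is
  \<open>S^j / j!\<close>, which accounts for the factor \<open>fact j\<close>.\<close>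

lemma expectation_sum_power:
  assumes f: "f \<in> F"
  shows "integrable M (\<lambda>\<omega>. (\<Sum>n\<in>Gen r. f (X n \<omega>)) ^ j)"
    and "(\<integral>\<omega>. (\<Sum>n\<in>Gen r. f (X n \<omega>)) ^ j \<partial>M) = fact j * integral\<^sup>L \<nu> (mom f r j)"
proof -
  let ?w = "\<lambda>k x. f x ^ k / fact k"
  have w: "?w k \<in> F" for k
    using F_mom[OF f, of 0 k] by (simp add: mom_def)
  have "(\<Prod>n\<in>Gen r. Abs_fps (\<lambda>k. ?w k (X n \<omega>))) = fps_exp (\<Sum>n\<in>Gen r. f (X n \<omega>))" for \<omega>
    by (simp add: fps_exp_sum[OF finite_Gen]) (simp add: fps_exp_def)
  then have eq: "(\<Sum>n\<in>Gen r. f (X n \<omega>)) ^ j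
      = fact j * fps_nth (\<Prod>n\<in>Gen r. Abs_fps (\<lambda>k. ?w k (X n \<omega>))) j" for \<omega>
    by simp
  show "integrable M (\<lambda>\<omega>. (\<Sum>n\<in>Gen r. f (X n \<omega>)) ^ j)"
    unfolding eq by (intro integrable_mult_right integrable_fps_prod_nth w)
  show "(\<integral>\<omega>. (\<Sum>n\<in>Gen r. f (X n \<omega>)) ^ j \<partial>M) = fact j * integral\<^sup>L \<nu> (mom f r j)"
    unfolding eq by (simp add: expectation_fps_prod[OF w] mom_def del: fps_nth_Abs_fps)
qed

section \<open>Moment recursions and bounds up to order four\<close>

lemma mom_Suc: "mom f (Suc r) k x = (\<Sum>i=0..k. Ptens P (mom f r i) (mom f r (k - i)) x)"
  by (simp add: mom_def branch_def)

lemma mom_0: "mom f r 0 = (\<lambda>_. 1)"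
proof (induction r)
  case (Suc r)
  interpret prob_space "P x" for x by (rule prob_space_P)
  show ?case
    using Suc prob_space by (auto simp: mom_Suc Ptens_def fun_eq_iff)
qed (simp add: mom_def)

lemma Qop_eq_Ptens: "2 * Qop P u x = Ptens P u (\<lambda>_. 1) x + Ptens P (\<lambda>_. 1) u x"
  by (simp add: Qop_def Ptens_def)

text \<open>The many-to-one formula: along a uniformly chosen line of descent the chain moves by
  \<open>Q\<close>.\<close>

lemma mom_1: "f \<in> F \<Longrightarrow> mom f r 1 x = 2^r * Qpow P r f x"
proof (induction r arbitrary: x)
  case (Suc r)
  \<comment> \<open>The added zero matches the shape of \<open>Qop_add\<close>.\<close>
  then have "mom f r 1 = (\<lambda>x. 2^r * Qpow P r f x + 0)" by auto
  then have "mom f (Suc r) 1 x = 2 * Qop P (\<lambda>x. 2^r * Qpow P r f x + 0) x"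
    by (simp add: mom_Suc mom_0 Qop_eq_Ptens)
  then show ?case
    unfolding Qop_add[OF F_Qpow[OF Suc.prems] F_const] by (simp add: Qpow_def Qop_def)
qed (simp add: mom_def Qpow_def)

text \<open>As the zeroth moment is 1, the two extreme terms of the convolution combine to
  \<open>2 Q\<close>. The middle terms involve lower orders only and play the role of the error in
  \<open>affine_recursion_bound\<close>.\<close>

lemma mom_Suc_2: "mom f (Suc r) 2 x = 2 * Qop P (mom f r 2) x + Ptens P (mom f r 1) (mom f r 1) x"
  and mom_Suc_3: "mom f (Suc r) 3 x = 2 * Qop P (mom f r 3) x
    + (Ptens P (mom f r 1) (mom f r 2) x + Ptens P (mom f r 2) (mom f r 1) x)"
  and mom_Suc_4: "mom f (Suc r) 4 x = 2 * Qop P (mom f r 4) x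
    + (Ptens P (mom f r 1) (mom f r 3) x + Ptens P (mom f r 3) (mom f r 1) x
       + Ptens P (mom f r 2) (mom f r 2) x)"
  by (simp_all add: mom_Suc Qop_eq_Ptens mom_0 numeral_eq_Suc)

lemma mom_4_bound:
  assumes H1: "hyp_H1 F P \<mu> \<alpha>" and f: "f \<in> F" "(\<integral>x. f x \<partial>\<mu>) = 0"
  shows "\<exists>g\<in>F. \<forall>r x. \<bar>mom f r 4 x\<bar> \<le> 4 * 4^r * (\<Sum>s\<le>r. (2 * \<alpha>\<^sup>2)^s)\<^sup>2 * g x"
proof -
  have \<alpha>: "0 < \<alpha>" "\<alpha> < 1" using H1 by (auto simp: hyp_H1_def)
  define A where "A r = (\<Sum>s\<le>r. (2 * \<alpha>\<^sup>2)^s)" for r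
  have A1: "1 \<le> A r" for r
    using \<alpha> member_le_sum[of 0 "{..r}" "\<lambda>s. (2 * \<alpha>\<^sup>2)^s"] by (simp add: A_def)
  have A_mono: "A q \<le> A r" if "q \<le> r" for q r
    using that \<alpha> unfolding A_def by (intro sum_mono2) auto
  have A_sum: "(\<Sum>q<r. (2 * \<alpha>\<^sup>2)^q) \<le> A r" for r
    using \<alpha> unfolding A_def by (intro sum_mono2) auto
  have A_sq1: "1 \<le> (A r)\<^sup>2" for r
    using A1 by simp
  obtain g1 where g1: "g1 \<in> F" and Q1: "\<And>r x. \<bar>Qpow P r f x\<bar> \<le> \<alpha>^r * g1 x"
    using H1 f unfolding hyp_H1_def by blast
  \<comment> \<open>\<open>D1\<close>, \<open>D2\<close>, \<open>D3\<close> are the growth rates of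
    the first three moments. \<open>D1\<close> comes from \<open>mom_1\<close> and (H1). The others
    come from \<open>2^r * (1 + (\<Sum>q<r. E q / 2^q))\<close>: with \<open>E = D1 * D1\<close> the
    summand is \<open>(2 * \<alpha>^2)^q\<close>, and \<open>1 \<le> A r\<close> bounds the bracket
    by \<open>2 * A r\<close>; with \<open>E = D1 * D2\<close> the factor \<open>D2 q / 2^q\<close>
    is \<open>2 * A q\<close>.\<close>
  define D1 where "D1 r = (2 * \<alpha>)^r" for r
  define D2 where "D2 r = 2^r * 2 * A r" for r
  define D3 where "D3 r = 2^r * (1 + (\<Sum>q<r. D1 q * (2 * A q)))" for r
  have D1_pos: "0 < D1 r" for r using \<alpha> by (simp add: D1_def)
  have D2_pos: "0 < D2 r" for r using A1[of r] by (simp add: D2_def)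
  have D3_pos: "0 < D3 r" for r
    using A1 D1_pos unfolding D3_def
    by (intro mult_pos_pos add_pos_nonneg sum_nonneg mult_nonneg_nonneg)
       (auto intro: less_imp_le order_trans[OF zero_le_one])
  have m1: "\<bar>mom f r 1 x\<bar> \<le> D1 r * g1 x" for r x
    using mult_left_mono[OF Q1[of r x], of "2^r"]
    unfolding mom_1[OF f(1)] by (simp add: D1_def power_mult_distrib abs_mult mult_ac)
  note F_intros = F_mom[OF f(1)] F_Ptens F_add
  have "\<exists>g\<in>F. \<forall>r x. \<bar>mom f r 2 x\<bar> \<le> D2 r * g x"
  proof (rule affine_recursion_bound[where v="\<lambda>r. mom f r 2", OF _ _ _ mom_Suc_2])
    show "\<bar>Ptens P (mom f r 1) (mom f r 1) x\<bar> \<le> (D1 r * D1 r) * Ptens P g1 g1 x" for r x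
      by (intro Ptens_abs_le F_intros g1 m1)
    have "D1 q * D1 q / 2^q = (2 * \<alpha>\<^sup>2)^q" for q
      unfolding D1_def power_mult_distrib[symmetric] power_divide[symmetric]
      by (rule arg_cong[where f="\<lambda>t. t^q"]) (simp add: power2_eq_square)
    then have "2^r * (1 + (\<Sum>q<r. D1 q * D1 q / 2^q)) \<le> 2^r * (A r + A r)" for r
      using A1[of r] A_sum[of r] by simp
    then show "2^r * (1 + (\<Sum>q<r. D1 q * D1 q / 2^q)) \<le> D2 r" for r
      by (simp add: D2_def)
  qed (auto intro!: F_intros g1)
  then obtain g2 where g2: "g2 \<in> F" and m2: "\<And>r x. \<bar>mom f r 2 x\<bar> \<le> D2 r * g2 x"
    by blast
  have "\<exists>g\<in>F. \<forall>r x. \<bar>mom f r 3 x\<bar> \<le> D3 r * g x"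
  proof (rule affine_recursion_bound[where v="\<lambda>r. mom f r 3", OF _ _ _ mom_Suc_3])
    show "\<bar>Ptens P (mom f r 1) (mom f r 2) x + Ptens P (mom f r 2) (mom f r 1) x\<bar>
        \<le> (D1 r * D2 r) * (Ptens P g1 g2 x + Ptens P g2 g1 x)" for r x
    proof -
      have "\<bar>Ptens P (mom f r 1) (mom f r 2) x\<bar> \<le> D1 r * D2 r * Ptens P g1 g2 x"
        by (intro Ptens_abs_le F_intros g1 g2 m1 m2)
      moreover have "\<bar>Ptens P (mom f r 2) (mom f r 1) x\<bar> \<le> D2 r * D1 r * Ptens P g2 g1 x"
        by (intro Ptens_abs_le F_intros g1 g2 m1 m2)
      ultimately show ?thesis
        by (simp add: algebra_simps)
    qed
    show "2^r * (1 + (\<Sum>q<r. D1 q * D2 q / 2^q)) \<le> D3 r" for r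
      by (simp add: D2_def D3_def)
    show "0 \<le> D1 r * D2 r" for r
      using D1_pos[of r] D2_pos[of r] by simp
  qed (auto intro!: F_intros g1 g2)
  then obtain g3 where g3: "g3 \<in> F" and m3: "\<And>r x. \<bar>mom f r 3 x\<bar> \<le> D3 r * g3 x"
    by blast
  have four: "2^r * (2^r * t) = 4^r * t" for r and t :: real
    using power_mult_distrib[of "2::real" 2 r] by simp
  text \<open>\<open>\<alpha>\<^sup>r (2\<alpha>)\<^sup>q \<le> (2\<alpha>\<^sup>2)\<^sup>q\<close> for \<open>q < r\<close>, so the first-times-third moment term is dominated by the
    square of the second moment in all three regimes.\<close>
  have D13: "D1 r * D3 r \<le> D2 r * D2 r" for r
  proof -
    have "\<alpha>^r * (D1 q * (2 * A q)) \<le> (2 * \<alpha>\<^sup>2)^q * (2 * A r)" if "q < r" for q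
    proof -
      have "\<alpha>^r * D1 q \<le> \<alpha>^q * D1 q"
        using \<alpha> that D1_pos[of q] by (intro mult_right_mono power_decreasing) auto
      also have "\<dots> = (2 * \<alpha>\<^sup>2)^q"
        unfolding D1_def power_mult_distrib[symmetric]
        by (rule arg_cong[where f="\<lambda>t. t^q"]) (simp add: power2_eq_square)
      finally have "(\<alpha>^r * D1 q) * (2 * A q) \<le> (2 * \<alpha>\<^sup>2)^q * (2 * A r)"
        using A_mono[of q r] A1[of q] \<alpha> that by (intro mult_mono) auto
      then show ?thesis by (simp add: mult_ac)
    qed
    then have "\<alpha>^r * (\<Sum>q<r. D1 q * (2 * A q)) \<le> (\<Sum>q<r. (2 * \<alpha>\<^sup>2)^q * (2 * A r))"
      unfolding sum_distrib_left by (intro sum_mono) auto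
    also have "\<dots> \<le> A r * (2 * A r)"
      unfolding sum_distrib_right[symmetric] using A1[of r] by (intro mult_right_mono A_sum) auto
    \<comment> \<open>The leading 1 stays at most 1 after multiplication by
      \<open>\<alpha>^r\<close>, and is then absorbed using \<open>1 \<le> A r\<close>.\<close>
    finally have "\<alpha>^r * (1 + (\<Sum>q<r. D1 q * (2 * A q))) \<le> 1 + 2 * (A r)\<^sup>2"
      using power_le_one[of \<alpha> r] \<alpha> by (simp add: power2_eq_square distrib_left)
    also have "\<dots> \<le> 4 * (A r)\<^sup>2"
      using A_sq1[of r] by simp
    finally have "4^r * (\<alpha>^r * (1 + (\<Sum>q<r. D1 q * (2 * A q)))) \<le> 4^r * (4 * (A r)\<^sup>2)"
      by simp
    moreover have "D1 r * D3 r = 4^r * (\<alpha>^r * (1 + (\<Sum>q<r. D1 q * (2 * A q))))"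
      by (simp add: D3_def D1_def power_mult_distrib mult_ac four)
    moreover have "D2 r * D2 r = 2^r * (2^r * (4 * (A r)\<^sup>2))"
      by (simp add: D2_def power2_eq_square)
    then have "D2 r * D2 r = 4^r * (4 * (A r)\<^sup>2)"
      unfolding four .
    ultimately show ?thesis by simp
  qed
  \<comment> \<open>Enlarging the constant requires \<open>0 \<le> p\<close>, which follows from the
    bound itself once \<open>c\<close> is strictly positive; hence the strict positivity of
    \<open>D1\<close> and \<open>D3\<close>.\<close>
  have weaken: "\<bar>t\<bar> \<le> c' * p" if "\<bar>t\<bar> \<le> c * p" "0 < c" "c \<le> c'" for t c c' p :: real
  proof -
    have "0 \<le> c * p" using that(1) by linarith
    then have "0 \<le> p" using that(2) by (simp add: zero_le_mult_iff)
    then show ?thesis using that(1) mult_right_mono[OF that(3)] by fastforce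
  qed
  have "\<exists>g\<in>F. \<forall>r x. \<bar>mom f r 4 x\<bar> \<le> (4 * 4^r * (A r)\<^sup>2) * g x"
  proof (rule affine_recursion_bound[where v="\<lambda>r. mom f r 4", OF _ _ _ mom_Suc_4])
    show "\<bar>Ptens P (mom f r 1) (mom f r 3) x + Ptens P (mom f r 3) (mom f r 1) x
         + Ptens P (mom f r 2) (mom f r 2) x\<bar>
        \<le> (D2 r * D2 r) * (Ptens P g1 g3 x + Ptens P g3 g1 x + Ptens P g2 g2 x)" for r x
    proof -
      have pos: "0 < D1 r * D3 r"
        by (intro mult_pos_pos D1_pos D3_pos)
      have "\<bar>Ptens P (mom f r 1) (mom f r 3) x\<bar> \<le> D1 r * D3 r * Ptens P g1 g3 x"
        by (intro Ptens_abs_le F_intros g1 g3 m1 m3)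
      then have "\<bar>Ptens P (mom f r 1) (mom f r 3) x\<bar> \<le> D2 r * D2 r * Ptens P g1 g3 x"
        by (rule weaken[OF _ pos D13])
      moreover have "\<bar>Ptens P (mom f r 3) (mom f r 1) x\<bar> \<le> D3 r * D1 r * Ptens P g3 g1 x"
        by (intro Ptens_abs_le F_intros g1 g3 m1 m3)
      then have "\<bar>Ptens P (mom f r 3) (mom f r 1) x\<bar> \<le> D2 r * D2 r * Ptens P g3 g1 x"
        unfolding mult.commute[of "D3 r"] by (rule weaken[OF _ pos D13])
      moreover have "\<bar>Ptens P (mom f r 2) (mom f r 2) x\<bar> \<le> D2 r * D2 r * Ptens P g2 g2 x"
        by (intro Ptens_abs_le F_intros g2 m2)
      ultimately show ?thesis
        by (simp add: algebra_simps)
    qed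
    show "0 \<le> D2 r * D2 r" for r by simp
    show "2^r * (1 + (\<Sum>q<r. D2 q * D2 q / 2^q)) \<le> 4 * 4^r * (A r)\<^sup>2" for r
    proof -
      \<comment> \<open>Replacing \<open>A q\<close> by \<open>A r\<close> leaves a geometric sum
        equal to \<open>2^r - 1\<close>; the missing unit makes room for the 1 in the
        bracket.\<close>
      have "D2 q * D2 q / 2^q \<le> 2^q * (4 * (A r)\<^sup>2)" if "q < r" for q
        using power_mono[OF A_mono[of q r], of 2] A1[of q] that
        by (simp add: D2_def power2_eq_square)
      then have "(\<Sum>q<r. D2 q * D2 q / 2^q) \<le> (\<Sum>q<r. 2^q * (4 * (A r)\<^sup>2))"
        by (intro sum_mono) auto
      also have "\<dots> = (2^r - 1) * (4 * (A r)\<^sup>2)"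
        unfolding sum_distrib_right[symmetric] by (simp add: sum_gp_strict)
      finally have "1 + (\<Sum>q<r. D2 q * D2 q / 2^q) \<le> 2^r * (4 * (A r)\<^sup>2)"
        using A_sq1[of r] by (simp add: algebra_simps)
      then have "2^r * (1 + (\<Sum>q<r. D2 q * D2 q / 2^q)) \<le> 2^r * (2^r * (4 * (A r)\<^sup>2))"
        by simp
      also have "\<dots> = 4 * 4^r * (A r)\<^sup>2"
        by (simp add: four)
      finally show ?thesis .
    qed
  qed (auto intro!: F_intros g1 g2 g3)
  then show ?thesis by (simp add: A_def)
qed

end

section \<open>The three regimes and the final estimate\<close>

text \<open>With ratio \<open>b = 2 * \<alpha>^2\<close> the geometric sum is bounded if
  \<open>b < 1\<close>, equals \<open>r + 1\<close> if \<open>b = 1\<close>, and is of order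
  \<open>b^r\<close> if \<open>b > 1\<close>; in the last case
  \<open>(b^2 / 4)^r = \<alpha>^(4 * r)\<close>.\<close>

lemma geometric_sum_rate:
  fixes \<alpha> :: real
  assumes "0 < \<alpha>"
  shows "\<exists>K>0. \<forall>r::nat. (\<alpha>\<^sup>2 = 1/2 \<longrightarrow> r \<ge> 1) \<longrightarrow>
    (1/4)^r * (\<Sum>s\<le>r. (2 * \<alpha>\<^sup>2)^s)\<^sup>2 \<le> K * (if \<alpha>\<^sup>2 < 1/2 then (1/4)^r
      else if \<alpha>\<^sup>2 = 1/2 then (real r)\<^sup>2 * (1/4)^r else \<alpha>^(4 * r))"
proof -
  define b where "b = 2 * \<alpha>\<^sup>2"
  have b: "0 < b" using assms by (simp add: b_def)
  have sum0: "0 \<le> (\<Sum>s\<le>r. b^s)" for r using b by (intro sum_nonneg) auto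
  consider "\<alpha>\<^sup>2 < 1/2" | "\<alpha>\<^sup>2 = 1/2" | "\<alpha>\<^sup>2 > 1/2" by linarith
  then show ?thesis
  proof cases
    case 1
    then have b1: "b < 1" by (simp add: b_def)
    have "(\<Sum>s\<le>r. b^s) \<le> 1 / (1 - b)" for r
      using b b1 by (simp add: sum_gp0 divide_right_mono)
    then have "(\<Sum>s\<le>r. b^s)\<^sup>2 \<le> (1 / (1 - b))\<^sup>2" for r
      using sum0 by (intro power_mono) auto
    with 1 b1 show ?thesis
      by (intro exI[of _ "(1 / (1 - b))\<^sup>2"]) (auto simp: b_def[symmetric] mult.commute)
  next
    case 2
    \<comment> \<open>At \<open>r = 0\<close> the right side vanishes while the left is 1; from
      \<open>r = 1\<close> on, \<open>1 + r \<le> 2 r\<close> gives the constant 4.\<close>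
    have "(1/4)^r * (\<Sum>s\<le>r. (2 * \<alpha>\<^sup>2)^s)\<^sup>2 \<le> 4 * ((real r)\<^sup>2 * (1/4)^r)" if "r \<ge> 1" for r
    proof -
      have "(1 + real r)\<^sup>2 \<le> (2 * real r)\<^sup>2" using that by (intro power_mono) auto
      moreover have "2 * \<alpha>\<^sup>2 = 1" using 2 by simp
      ultimately show ?thesis by (simp add: power_mult_distrib del: power_one_over)
    qed
    with 2 show ?thesis by (intro exI[of _ 4]) auto
  next
    case 3
    then have b1: "1 < b" by (simp add: b_def)
    have "(\<Sum>s\<le>r. b^s) \<le> b / (b - 1) * b^r" for r
    proof -
      have "(\<Sum>s\<le>r. b^s) = (b * b^r - 1) / (b - 1)"
        using b1 by (simp add: sum_gp0 field_simps)
      also have "\<dots> \<le> (b * b^r) / (b - 1)"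
        using b1 by (intro divide_right_mono) auto
      finally show ?thesis by simp
    qed
    then have "(\<Sum>s\<le>r. b^s)\<^sup>2 \<le> (b / (b - 1) * b^r)\<^sup>2" for r
      using sum0 by (intro power_mono) auto
    then have "(1/4)^r * (\<Sum>s\<le>r. b^s)\<^sup>2 \<le> (1/4)^r * (b / (b - 1) * b^r)\<^sup>2" for r
      by (intro mult_left_mono) auto
    moreover have "(1/4)^r * (b / (b - 1) * b^r)\<^sup>2 = (b / (b - 1))\<^sup>2 * \<alpha>^(4 * r)" for r
    proof -
      have "(b^r)\<^sup>2 = (b\<^sup>2)^r" by (simp add: power_mult[symmetric] mult.commute)
      also have "b\<^sup>2 = 4 * \<alpha>^4" by (simp add: b_def power_mult_distrib flip: power_mult)
      finally show ?thesis
        by (simp add: power_mult_distrib power_divide power_mult)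
    qed
    ultimately have "(1/4)^r * (\<Sum>s\<le>r. b^s)\<^sup>2 \<le> (b / (b - 1))\<^sup>2 * \<alpha>^(4 * r)" for r
      by metis
    moreover have "0 < (b / (b - 1))\<^sup>2" using b1 by simp
    ultimately show ?thesis
      using 3 unfolding b_def[symmetric] by (intro exI[of _ "(b / (b - 1))\<^sup>2"]) auto
  qed
qed

theorem theorem2p1:
  fixes M :: "'w measure" and X :: "nat \<Rightarrow> 'w \<Rightarrow> 'a::metric_space"
    and \<nu> \<mu> :: "'a measure" and P :: "'a \<Rightarrow> ('a \<times> 'a) measure"
    and F :: "('a \<Rightarrow> real) set" and \<alpha> :: real and f :: "'a \<Rightarrow> real"
  assumes "bifurcating_MC M X \<nu> P"
    and "F_conditions F P \<mu> \<nu>"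
    and "hyp_H1 F P \<mu> \<alpha>"
    and "f \<in> F" and "(\<integral>x. f x \<partial>\<mu>) = 0"
  shows "\<exists>c>0. \<forall>r::nat. (\<alpha>\<^sup>2 = 1/2 \<longrightarrow> r \<ge> 1) \<longrightarrow>
           (\<integral>\<^sup>+ \<omega>. ennreal ((Mbar X r f \<omega>) ^ 4) \<partial>M)
         \<le> ennreal (if \<alpha>\<^sup>2 < 1/2 then c * (1/4) ^ r
                    else if \<alpha>\<^sup>2 = 1/2 then c * (real r)\<^sup>2 * (1/4) ^ r
                    else c * \<alpha> ^ (4 * r))"
proof -
  interpret bmc M X \<nu> \<mu> P F
    by standard (fact assms)+
  define A where "A r = (\<Sum>s\<le>r. (2 * \<alpha>\<^sup>2)^s)" for r
  define rate where "rate r = (if \<alpha>\<^sup>2 < 1/2 then (1/4)^r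
      else if \<alpha>\<^sup>2 = 1/2 then (real r)\<^sup>2 * (1/4)^r else \<alpha>^(4 * r))" for r
  have \<alpha>: "0 < \<alpha>" using assms(3) by (simp add: hyp_H1_def)
  from geometric_sum_rate[OF \<alpha>] obtain K where K: "0 < K"
    "\<And>r. (\<alpha>\<^sup>2 = 1/2 \<longrightarrow> r \<ge> 1) \<Longrightarrow> (1/4)^r * (A r)\<^sup>2 \<le> K * rate r"
    by (auto simp: A_def rate_def)
  obtain g where g: "g \<in> F" "\<And>r x. \<bar>mom f r 4 x\<bar> \<le> 4 * 4^r * (A r)\<^sup>2 * g x"
    using mom_4_bound[OF assms(3-5)] by (auto simp: A_def)
  define G where "G = \<bar>integral\<^sup>L \<nu> g\<bar>"
  \<comment> \<open>\<open>96 = 24 * 4\<close>: the 24 is the \<open>4!\<close> in the definition of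
    \<open>mom\<close>, the 4 comes from \<open>mom_4_bound\<close>. The added 1 keeps
    \<open>c\<close> positive when \<open>G = 0\<close>.\<close>
  define c where "c = K * (96 * G + 1)"
  have "0 < c" using K(1) by (simp add: c_def G_def add_nonneg_pos)
  moreover have "(\<integral>\<^sup>+ \<omega>. ennreal ((Mbar X r f \<omega>) ^ 4) \<partial>M) \<le> ennreal (c * rate r)"
    if r: "\<alpha>\<^sup>2 = 1/2 \<longrightarrow> r \<ge> 1" for r
  proof -
    let ?S = "\<lambda>\<omega>. \<Sum>n\<in>Gen r. f (X n \<omega>)"
    have M4: "(Mbar X r f \<omega>) ^ 4 = (1/16)^r * ?S \<omega> ^ 4" for \<omega>
      by (simp add: Mbar_def card_Gen power_divide power_mult[symmetric] mult.commute[of r])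
        (simp add: power_mult)
    \<comment> \<open>Integrability of the fourth power makes the nonnegative integral finite and
      equal to the real-valued one.\<close>
    have "(\<integral>\<^sup>+ \<omega>. ennreal ((Mbar X r f \<omega>) ^ 4) \<partial>M) = ennreal (\<integral>\<omega>. (1/16)^r * ?S \<omega> ^ 4 \<partial>M)"
      unfolding M4 using expectation_sum_power(1)[OF assms(4)]
      by (intro nn_integral_eq_integral integrable_mult_right) auto
    also have "(\<integral>\<omega>. (1/16)^r * ?S \<omega> ^ 4 \<partial>M) = (1/16)^r * (24 * integral\<^sup>L \<nu> (mom f r 4))"
      using expectation_sum_power(2)[OF assms(4), of r 4] by (simp add: fact_numeral)
    also have "\<dots> \<le> (1/16)^r * (24 * (4 * 4^r * (A r)\<^sup>2 * G))"
    proof -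
      have "integral\<^sup>L \<nu> (mom f r 4) \<le> (\<integral>x. 4 * 4^r * (A r)\<^sup>2 * g x \<partial>\<nu>)"
        using g(2) abs_le_D1
        by (intro integral_mono F_integrable F_mom F_scale assms(4) g(1)) blast
      also have "\<dots> \<le> 4 * 4^r * (A r)\<^sup>2 * G"
        by (simp add: G_def mult_left_mono)
      finally show ?thesis by (intro mult_left_mono) auto
    qed
    \<comment> \<open>The normalisation \<open>16^(-r)\<close> against the growth \<open>4^r\<close>
      leaves \<open>4^(-r)\<close>.\<close>
    also have "\<dots> = 96 * G * ((1/4)^r * (A r)\<^sup>2)"
      using power_mult_distrib[of "1/16" "4::real" r] by simp
    also have "\<dots> \<le> 96 * G * (K * rate r)"
      using K(2)[OF r] by (intro mult_left_mono) (auto simp: G_def)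
    also have "\<dots> \<le> c * rate r"
      using K(1) \<alpha> by (simp add: c_def algebra_simps rate_def)
    finally show ?thesis by (simp add: ennreal_leI)
  qed
  ultimately show ?thesis
    by (intro exI[of _ c]) (auto simp: rate_def mult.assoc)
qed

end
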